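(* Let $n\ge1$ and fix a Dyck path $\alpha$ of length $2n$. The number of permutations $w\in\mathfrak{S}_{2n}$ with $p_A(w)=\alpha$ equals \[2\cdot4\cdot6\cdots(2n)\prod_{i=1}^n h_i(\alpha).\]
   Context: A Dyck path of length $2N$ is a lattice path from $(0,0)$ to $(2N,0)$ with steps $(1,1)$ (up) and $(1,-1)$ (down) staying weakly above the $x$-axis; the down step ending at $x$-coordinate $k$ and going from height $h$ to $h-1$ is at position $k$ with height $h$; the path is determined by its set of down-step positions. $h_i(p)$ is the height of the $i$th down step of $p$. Crossout procedure: for $w\in\mathfrak{S}_{2n}$ in one-line notation, repeat until all positions are marked: mark "B" at the unmarked position $i$ with smallest value $w(i)$, then mark "A" at the leftmost unmarked position. $\mathcal{A}(w)$ is the set of positions marked A. $p_A(w)$ is the Dyck path of length $2n$ whose down-step positions are $\{w(a):a\in\mathcal{A}(w)\}$. *)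

theory Defs
  imports Complex_Main "HOL-Library.While_Combinator" "HOL-Combinatorics.Permutations"
begin

datatype step = Up | Down

definition height :: "step list \<Rightarrow> nat \<Rightarrow> int" where
  "height p k = int (count_list (take k p) Up) - int (count_list (take k p) Down)"

definition dyck_path :: "nat \<Rightarrow> step list \<Rightarrow> bool" where
  "dyck_path l p \<longleftrightarrow>
     length p = l \<and> (\<forall>k\<le>l. 0 \<le> height p k) \<and> height p l = 0"

(* The step ending at x-coordinate k is list entry k - 1, as lists are indexed from 0. *)
definition down_positions :: "step list \<Rightarrow> nat set" where
  "down_positions p = {k. 1 \<le> k \<and> k \<le> length p \<and> p ! (k - 1) = Down}"

(* A down step at position k starts at x-coordinate k - 1, and its height is that of its
   starting point.  The index i counts down steps from 1, from left to right. *)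
definition down_height :: "nat \<Rightarrow> step list \<Rightarrow> int" where
  "down_height i p = height p (sorted_list_of_set (down_positions p) ! (i - 1) - 1)"

(* A state (U, A) consists of the unmarked positions U and the positions A marked "A";
   the positions marked "B" are all the others. *)
definition crossout_step :: "(nat \<Rightarrow> nat) \<Rightarrow> nat set \<times> nat set \<Rightarrow> nat set \<times> nat set" where
  "crossout_step w = (\<lambda>(U, A).
     let b = arg_min_on w U;
         a = Min (U - {b})
     in (U - {b} - {a}, insert a A))"

definition crossout_A :: "nat \<Rightarrow> (nat \<Rightarrow> nat) \<Rightarrow> nat set" where
  "crossout_A n w =
     snd (while (\<lambda>(U, A). U \<noteq> {}) (crossout_step w) ({1..2 * n}, {}))"

(* The list of steps whose down-step positions are w ` crossout_A n w.  That it is a Dyck path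
   with exactly these down-step positions is dyck_path_path_A and down_positions_path_A below. *)
definition path_A :: "nat \<Rightarrow> (nat \<Rightarrow> nat) \<Rightarrow> step list" where
  "path_A n w = map (\<lambda>k. if k \<in> w ` crossout_A n w then Down else Up) [1..<2 * n + 1]"

lemma step_list_eqI:
  assumes "length p = length q" "down_positions p = down_positions q"
  shows "p = q"
proof (rule nth_equalityI)
  fix i assume i: "i < length p"
  have "p ! i = Down \<longleftrightarrow> Suc i \<in> down_positions p"
    using i by (simp add: down_positions_def)
  also have "\<dots> \<longleftrightarrow> q ! i = Down"
    using i assms by (simp add: down_positions_def)
  finally show "p ! i = q ! i"
    by (metis step.exhaust)
qed (fact assms(1))

lemma while_crossout:
  assumes "finite U" "even (card U)"
  shows "\<exists>R. while (\<lambda>(U, A). U \<noteq> {}) (crossout_step w) (U, A) = ({}, R \<union> A) \<and> R \<subseteq> U \<and>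
           2 * card R = card U \<and>
           (\<forall>k. 2 * card {i \<in> R. w i \<le> k} \<le> card {i \<in> U. w i \<le> k})"
  using assms
proof (induction "card U" arbitrary: U A rule: less_induct)
  case less
  show ?case
  proof (cases "U = {}")
    case True
    then show ?thesis by (subst while_unfold) auto
  next
    case False
    define b where "b = arg_min_on w U"
    define a where "a = Min (U - {b})"
    define V where "V = U - {b} - {a}"
    have b: "b \<in> U" "\<And>i. i \<in> U \<Longrightarrow> w b \<le> w i"
      using arg_min_if_finite[OF less.prems(1) False, of w] by (auto simp: b_def not_less)
    have "U - {b} \<noteq> {}"
    proof
      assume "U - {b} = {}"
      then have "U = {b}" using b(1) by blast
      then show False using less.prems(2) by simp
    qed
    then have a: "a \<in> U" "a \<noteq> b"
      using Min_in[of "U - {b}"] less.prems(1) by (auto simp: a_def)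
    have U: "U = insert a (insert b V)" "a \<notin> V" "b \<notin> V" "finite V"
      using a b less.prems(1) by (auto simp: V_def)
    then have cU: "card U = card V + 2"
      using a by auto
    obtain R where R: "while (\<lambda>(U, A). U \<noteq> {}) (crossout_step w) (V, insert a A)
          = ({}, R \<union> insert a A)" "R \<subseteq> V" "2 * card R = card V"
        "\<And>k. 2 * card {i \<in> R. w i \<le> k} \<le> card {i \<in> V. w i \<le> k}"
      using less.hyps[of V "insert a A"] cU U(4) less.prems(2) by auto
    have "crossout_step w (U, A) = (V, insert a A)"
      by (simp add: crossout_step_def Let_def a_def b_def V_def)
    then have w: "while (\<lambda>(U, A). U \<noteq> {}) (crossout_step w) (U, A) = ({}, insert a R \<union> A)"
      using False R(1) by (subst while_unfold) auto
    have fR: "finite R" "a \<notin> R"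
      using R(2) U finite_subset by auto
    have "2 * card {i \<in> insert a R. w i \<le> k} \<le> card {i \<in> U. w i \<le> k}" for k
    proof (cases "w a \<le> k")
      case True
      then have "w b \<le> k" using b(2)[OF a(1)] by simp
      then have "{i \<in> U. w i \<le> k} = insert a (insert b {i \<in> V. w i \<le> k})"
        and "{i \<in> insert a R. w i \<le> k} = insert a {i \<in> R. w i \<le> k}"
        using True U(1) by auto
      then show ?thesis
        using R(4)[of k] U fR a by simp
    next
      case False
      then have "{i \<in> insert a R. w i \<le> k} = {i \<in> R. w i \<le> k}" by auto
      moreover have "card {i \<in> V. w i \<le> k} \<le> card {i \<in> U. w i \<le> k}"
        using less.prems(1) by (intro card_mono) (auto simp: V_def)
      ultimately show ?thesis using R(4)[of k] by simp
    qed
    then show ?thesis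
      using w R(2,3) fR cU U by (intro exI[of _ "insert a R"]) auto
  qed
qed

lemma crossout_A_props:
  "crossout_A n w \<subseteq> {1..2 * n}"
  "card (crossout_A n w) = n"
  "2 * card {i \<in> crossout_A n w. w i \<le> k} \<le> card {i \<in> {1..2 * n}. w i \<le> k}"
proof -
  have "finite {1..2 * n}" "even (card {1..2 * n})" by simp_all
  from while_crossout[OF this, of w "{}"]
  obtain R where R:
      "while (\<lambda>(U, A). U \<noteq> {}) (crossout_step w) ({1..2 * n}, {}) = ({}, R \<union> {})"
      "R \<subseteq> {1..2 * n}" "2 * card R = card {1..2 * n}"
      "\<forall>k. 2 * card {i \<in> R. w i \<le> k} \<le> card {i \<in> {1..2 * n}. w i \<le> k}"
    by (elim exE conjE)
  have "crossout_A n w = R"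
    unfolding crossout_A_def R(1) by simp
  then show "crossout_A n w \<subseteq> {1..2 * n}" "card (crossout_A n w) = n"
    "2 * card {i \<in> crossout_A n w. w i \<le> k} \<le> card {i \<in> {1..2 * n}. w i \<le> k}"
    using R(2-4) by auto
qed

lemma down_positions_path_A:
  assumes "w permutes {1..2 * n}"
  shows "down_positions (path_A n w) = w ` crossout_A n w"
proof -
  have "w ` crossout_A n w \<subseteq> {1..2 * n}"
    using crossout_A_props(1)[of n w] permutes_image[OF assms] by blast
  moreover have "path_A n w ! (k - 1) = Down \<longleftrightarrow> k \<in> w ` crossout_A n w"
    if "1 \<le> k" "k \<le> 2 * n" for k
    using that by (simp add: path_A_def del: upt_Suc)
  moreover have "length (path_A n w) = 2 * n"
    by (simp add: path_A_def)
  ultimately show ?thesis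
    unfolding down_positions_def by auto
qed

lemma height_path_A:
  assumes "w permutes {1..2 * n}" and "k \<le> 2 * n"
  shows "height (path_A n w) k = int k - 2 * int (card {i \<in> crossout_A n w. w i \<le> k})"
proof -
  define D where "D = w ` crossout_A n w"
  have DU: "D \<subseteq> {1..2 * n}"
    using crossout_A_props(1)[of n w] permutes_image[OF assms(1)] by (auto simp: D_def)
  have "height (path_A n w) k = int k - 2 * int (card {j \<in> D. j \<le> k})"
    using assms(2)
  proof (induction k)
    case 0
    have "{j \<in> D. j \<le> 0} = {}" using DU by auto
    then show ?case by (simp add: height_def)
  next
    case (Suc k)
    have len: "length (path_A n w) = 2 * n" by (simp add: path_A_def)
    have nth: "path_A n w ! k = (if Suc k \<in> D then Down else Up)"
      using Suc.prems by (simp add: path_A_def D_def del: upt_Suc)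
    have fin: "finite D" using DU finite_subset by blast
    have "{j \<in> D. j \<le> Suc k} =
        (if Suc k \<in> D then insert (Suc k) {j \<in> D. j \<le> k} else {j \<in> D. j \<le> k})"
      by (auto simp: le_Suc_eq)
    then have "card {j \<in> D. j \<le> Suc k} = card {j \<in> D. j \<le> k} + (if Suc k \<in> D then 1 else 0)"
      using fin by simp
    then show ?case
      using Suc nth len by (simp add: height_def take_Suc_conv_app_nth)
  qed
  also have "{j \<in> D. j \<le> k} = w ` {i \<in> crossout_A n w. w i \<le> k}"
    by (auto simp: D_def)
  also have "card \<dots> = card {i \<in> crossout_A n w. w i \<le> k}"
    using permutes_inj[OF assms(1)] by (intro card_image) (auto simp: inj_on_def)
  finally show ?thesis .
qed

lemma dyck_path_path_A:
  assumes w: "w permutes {1..2 * n}"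
  shows "dyck_path (2 * n) (path_A n w)"
proof -
  have "0 \<le> height (path_A n w) k" if "k \<le> 2 * n" for k
  proof -
    have "w ` {i \<in> {1..2 * n}. w i \<le> k} \<subseteq> {1..k}"
    proof
      fix j assume "j \<in> w ` {i \<in> {1..2 * n}. w i \<le> k}"
      then obtain i where "i \<in> {1..2 * n}" "j = w i" "w i \<le> k" by blast
      moreover from this have "w i \<in> {1..2 * n}" by (simp only: permutes_in_image[OF w])
      ultimately show "j \<in> {1..k}" by simp
    qed
    moreover have "inj_on w {i \<in> {1..2 * n}. w i \<le> k}"
      using permutes_inj[OF w] by (auto simp: inj_on_def)
    ultimately have "card {i \<in> {1..2 * n}. w i \<le> k} \<le> k"
      using card_inj_on_le[of w "{i \<in> {1..2 * n}. w i \<le> k}" "{1..k}"] by simp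
    then show ?thesis
      using crossout_A_props(3)[of n w k] height_path_A[OF w that] by linarith
  qed
  moreover have "w i \<le> 2 * n" if "i \<in> crossout_A n w" for i
  proof -
    have "w i \<in> {1..2 * n}"
      using that crossout_A_props(1)[of n w] permutes_in_image[OF w, of i] by blast
    then show ?thesis by simp
  qed
  then have "{i \<in> crossout_A n w. w i \<le> 2 * n} = crossout_A n w" by auto
  then have "height (path_A n w) (2 * n) = 0"
    using height_path_A[OF w order_refl] crossout_A_props(2)[of n w] by simp
  ultimately show ?thesis
    by (simp add: dyck_path_def path_A_def)
qed

end

theory Submission
  imports Defs
begin

text \<open>
  The first round of the crossout procedure removes the smallest value and the value \<open>v\<close> in the
  leftmost remaining position; the position of the smallest value is arbitrary, so the number of
  bijections with A-values \<open>D\<close> on \<open>2n\<close> points is \<open>2n\<close> times the sum over \<open>v \<in> D\<close> of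
  the number of bijections with A-values \<open>D - {v}\<close> on the remaining points.  On the path side,
  deleting the first up step and the down step \<open>v\<close> lowers the down steps before \<open>v\<close> by one and
  leaves those after \<open>v\<close> unchanged, so the sum of the resulting height products telescopes to
  \<open>\<Prod>h - \<Prod>(h - 1)\<close>, and the second product vanishes because some down step has height 1.
\<close>

section \<open>Crossout on an arbitrary finite set of positions\<close>

text \<open>The positions left after a round need not form an initial interval, so the recursion
  runs over arbitrary sets; \<open>U = {1..2 * n}\<close> gives
  \<open>crossout_A n w\<close>.\<close>

definition cross :: "(nat \<Rightarrow> nat) \<Rightarrow> nat set \<Rightarrow> nat set" where
  "cross w U = snd (while (\<lambda>(U, A). U \<noteq> {}) (crossout_step w) (U, {}))"

lemma cross_empty [simp]: "cross w {} = {}"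
  by (simp add: cross_def while_unfold)

text \<open>A round inserts into the set of A-positions but never reads it, so the initial content
  just joins the outcome. Every round removes at least \<open>b\<close>, which drives the induction
  on \<open>card U\<close>.\<close>

lemma snd_while_crossout:
  assumes "finite U"
  shows "snd (while (\<lambda>(U, A). U \<noteq> {}) (crossout_step w) (U, A)) = cross w U \<union> A"
  using assms
proof (induction "card U" arbitrary: U A rule: less_induct)
  case less
  show ?case
  proof (cases "U = {}")
    case True
    then show ?thesis by (simp add: cross_def while_unfold)
  next
    case False
    define b where "b = arg_min_on w U"
    define a where "a = Min (U - {b})"
    have b: "b \<in> U"
      using arg_min_if_finite(1)[OF less.prems(1) False, of w] by (simp add: b_def)
    have step: "crossout_step w (U, X) = (U - {b} - {a}, insert a X)" for X
      by (simp add: crossout_step_def Let_def a_def b_def)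
    have "card (U - {b} - {a}) < card U"
      using b less.prems by (intro psubset_card_mono) auto
    then have IH: "snd (while (\<lambda>(U, A). U \<noteq> {}) (crossout_step w) (U - {b} - {a}, X))
        = cross w (U - {b} - {a}) \<union> X" for X
      using less by simp
    have "snd (while (\<lambda>(U, A). U \<noteq> {}) (crossout_step w) (U, X))
        = cross w (U - {b} - {a}) \<union> insert a X" for X
      using False IH by (subst while_unfold) (simp add: step)
    \<comment> \<open>The instance at \<open>{}\<close> computes \<open>cross w U\<close>
      itself.\<close>
    from this[of A] this[of "{}"] show ?thesis by (simp add: cross_def)
  qed
qed

text \<open>A strict minimum at \<open>b\<close> leaves \<open>arg_min_on\<close> no choice, so the
  first round is explicit and its A-position splits off.\<close>

lemma cross_step:
  assumes "finite U" "b \<in> U" "\<And>i. i \<in> U \<Longrightarrow> i \<noteq> b \<Longrightarrow> w b < w i" "a = Min (U - {b})"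
  shows "cross w U = insert a (cross w (U - {b} - {a}))"
proof -
  have "arg_min_on w U \<in> U" "\<not> (\<exists>x\<in>U. w x < w (arg_min_on w U))"
    using arg_min_if_finite[of U w] assms(1,2) by auto
  then have "arg_min_on w U = b"
    using assms(2,3) by blast
  then have "crossout_step w (U, {}) = (U - {b} - {a}, {a})"
    by (simp add: crossout_step_def Let_def assms(4))
  moreover have "U \<noteq> {}" using assms(2) by auto
  ultimately have "cross w U
      = snd (while (\<lambda>(U, A). U \<noteq> {}) (crossout_step w) (U - {b} - {a}, {a}))"
    by (simp add: cross_def while_unfold[of _ _ "(U, {})"])
  then show ?thesis
    using snd_while_crossout[of "U - {b} - {a}" w "{a}"] assms(1) by simp
qed

lemma cross_subset:
  assumes "finite U" "even (card U)"
  shows "cross w U \<subseteq> U"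
proof -
  obtain R where "while (\<lambda>(U, A). U \<noteq> {}) (crossout_step w) (U, {}) = ({}, R \<union> {})" "R \<subseteq> U"
    using while_crossout[OF assms, of w "{}"] by (elim exE conjE)
  then show ?thesis by (simp add: cross_def)
qed

text \<open>Rounds consult \<open>w\<close> only at unmarked positions, so values off
  \<open>U\<close> may be altered freely. Injectivity provides the strict minimum that
  \<open>cross_step\<close> asks for.\<close>

lemma cross_cong:
  assumes "finite U" "even (card U)" "inj_on w U" "\<And>i. i \<in> U \<Longrightarrow> w i = w' i"
  shows "cross w U = cross w' U"
  using assms
proof (induction "card U" arbitrary: U rule: less_induct)
  case less
  show ?case
  proof (cases "U = {}")
    case False
    define b where "b = arg_min_on w U"
    define a where "a = Min (U - {b})"
    have b: "b \<in> U" "\<And>i. i \<in> U \<Longrightarrow> w b \<le> w i"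
      using arg_min_if_finite[OF less.prems(1) False, of w] by (auto simp: b_def not_less)
    have lt: "w b < w i" if "i \<in> U" "i \<noteq> b" for i
      using b that less.prems(3) by (metis inj_onD order_le_less)
    \<comment> \<open>Evenness rules out a round with a single position left, where
      \<open>Min\<close> would be applied to the empty set.\<close>
    have "U - {b} \<noteq> {}"
      using b(1) less.prems(2)
      by (metis card.empty card_Suc_Diff1 less.prems(1) odd_one One_nat_def)
    then have a: "a \<in> U - {b}"
      using Min_in[of "U - {b}"] less.prems(1) by (simp add: a_def)
    have "card U = card (U - {b} - {a}) + 2"
      using a b less.prems(1) by (metis Suc_1 add_2_eq_Suc' card_Suc_Diff1 finite_Diff)
    then have "cross w (U - {b} - {a}) = cross w' (U - {b} - {a})"
      using less.prems by (intro less.hyps) (auto intro: inj_on_subset)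
    moreover have "cross w U = insert a (cross w (U - {b} - {a}))"
      using less.prems(1) b(1) lt a_def by (rule cross_step)
    moreover have "cross w' U = insert a (cross w' (U - {b} - {a}))"
      using less.prems(1) b(1) _ a_def by (rule cross_step) (use lt b(1) less.prems(4) in auto)
    ultimately show ?thesis by simp
  qed simp
qed

section \<open>Splitting off the first round\<close>

text \<open>Bijections are normalised to be the identity off \<open>U\<close>, so that for \<open>U = V\<close> they are the
  permutations of \<open>U\<close>.\<close>

definition cross_bijs :: "nat set \<Rightarrow> nat set \<Rightarrow> nat set \<Rightarrow> (nat \<Rightarrow> nat) set" where
  "cross_bijs U V D =
     {w. bij_betw w U V \<and> (\<forall>x. x \<notin> U \<longrightarrow> w x = x) \<and> w ` cross w U = D}"

lemma cross_bijs_subset: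
  assumes "finite U" "even (card U)" "w \<in> cross_bijs U V D"
  shows "D \<subseteq> V"
  using assms cross_subset[OF assms(1,2), of w]
  by (auto simp: cross_bijs_def bij_betw_def)

text \<open>Fixing the position \<open>b\<close> of the smallest value and the value
  \<open>v\<close> at \<open>a\<close> settles the first round; the rest of \<open>w\<close> is an
  arbitrary member for the smaller data. Resetting \<open>a\<close> and \<open>b\<close> to the
  identity respects the normalisation, and writing \<open>m\<close> and \<open>v\<close> back is the
  inverse.\<close>

lemma cross_bijs_piece:
  assumes U: "finite U" "even (card U)" and ba: "b \<in> U" "a \<in> U - {b}" "a = Min (U - {b})"
    and V: "finite V" "m = Min V" "m \<in> V" and v: "v \<in> D" "D \<subseteq> V" "v \<noteq> m"
  shows "bij_betw (\<lambda>w. w(b := b, a := a)) {w \<in> cross_bijs U V D. w b = m \<and> w a = v}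
           (cross_bijs (U - {b} - {a}) (V - {m} - {v}) (D - {v}))"
proof -
  define U' where "U' = U - {b} - {a}"
  define V' where "V' = V - {m} - {v}"
  have UU: "U = insert a (insert b U')" "a \<notin> U'" "b \<notin> U'" "a \<noteq> b" "finite U'"
    using ba(1,2) U by (auto simp: U'_def)
  have VV: "V = insert v (insert m V')" "v \<notin> V'" "m \<notin> V'" "v \<noteq> m"
    using V v by (auto simp: V'_def)
  have evU': "even (card U')"
    using UU U(2) by simp
  have mmin: "m < x" if "x \<in> V" "x \<noteq> m" for x
    using that V Min_le[of V x] by (simp add: order_le_less)
  \<comment> \<open>The smallest value sits at \<open>b\<close>, so the first round marks
    \<open>b\<close> with B and \<open>a\<close> with A; injectivity keeps \<open>v\<close> out of
    the A-values of later rounds.\<close>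
  have crossU: "w ` cross w U = insert v (w ` cross w U')" "v \<notin> w ` cross w U'"
    if w: "bij_betw w U V" "w b = m" "w a = v" for w
  proof -
    have "w b < w i" if "i \<in> U" "i \<noteq> b" for i
    proof -
      have "w i \<in> V" using w(1) that by (auto simp: bij_betw_def)
      moreover have "w i \<noteq> m" using w that ba(1) by (metis bij_betw_inv_into_left)
      ultimately show ?thesis using mmin w(2) by simp
    qed
    from cross_step[where w = w, OF U(1) ba(1) this ba(3)]
    have "cross w U = insert a (cross w U')" by (simp add: U'_def)
    then show "w ` cross w U = insert v (w ` cross w U')" using w(3) by simp
    show "v \<notin> w ` cross w U'"
    proof
      assume "v \<in> w ` cross w U'"
      then obtain i where "i \<in> U'" "w i = w a"
        using cross_subset[OF UU(5) evU', of w] w(3) by auto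
      moreover have "inj_on w U" using w(1) by (simp add: bij_betw_def)
      ultimately show False using UU by (metis inj_onD insertI1 insertI2)
    qed
  qed
  have bij_iff: "bij_betw w U V \<longleftrightarrow> bij_betw w U' V'" if "w b = m" "w a = v" for w
  proof
    assume w: "bij_betw w U V"
    then have "bij_betw w (U - {b, a}) (V - {m, v})"
      using that bij_betw_DiffI[OF w, of "{b, a}" "{m, v}"] UU VV by (auto simp: bij_betw_def)
    then show "bij_betw w U' V'"
      by (simp add: U'_def V'_def Diff_insert2[symmetric])
  next
    assume "bij_betw w U' V'"
    then have "bij_betw w (insert b U') (insert m V')"
      using UU VV that by (auto simp: bij_betw_def)
    then show "bij_betw w U V"
      using UU VV that by (auto simp: bij_betw_def)
  qed
  \<comment> \<open>Applied below to pairs of maps that differ at most at \<open>a\<close> and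
    \<open>b\<close>.\<close>
  have cong: "(bij_betw u U' V' \<longleftrightarrow> bij_betw w U' V') \<and>
      (bij_betw u U' V' \<longrightarrow> u ` cross u U' = w ` cross w U')"
    if "\<And>i. i \<in> U' \<Longrightarrow> u i = w i" for u w
  proof (intro conjI impI)
    show "bij_betw u U' V' \<longleftrightarrow> bij_betw w U' V'" using that by (rule bij_betw_cong)
    assume "bij_betw u U' V'"
    then have "cross u U' = cross w U'"
      using that UU evU' by (intro cross_cong) (auto simp: bij_betw_def)
    then show "u ` cross u U' = w ` cross w U'"
      using that cross_subset[OF UU(5) evU', of w] by (auto intro!: image_cong)
  qed
  show ?thesis
    unfolding U'_def[symmetric] V'_def[symmetric]
  proof (rule bij_betw_byWitness[where f' = "\<lambda>u. u(b := m, a := v)"])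
    show "\<forall>w\<in>{w \<in> cross_bijs U V D. w b = m \<and> w a = v}.
        (w(b := b, a := a))(b := m, a := v) = w"
      by auto
    show "\<forall>u\<in>cross_bijs U' V' (D - {v}). (u(b := m, a := v))(b := b, a := a) = u"
      using UU by (auto simp: cross_bijs_def fun_eq_iff)
    show "(\<lambda>w. w(b := b, a := a)) ` {w \<in> cross_bijs U V D. w b = m \<and> w a = v}
        \<subseteq> cross_bijs U' V' (D - {v})"
    proof (clarify)
      fix w assume w: "w \<in> cross_bijs U V D" "m = w b" "v = w a"
      let ?u = "w(b := b, a := a)"
      have bw: "bij_betw w U V" "bij_betw w U' V'"
        using w bij_iff[of w] by (auto simp: cross_bijs_def)
      have "D = insert v (w ` cross w U')" "v \<notin> w ` cross w U'"
        using crossU[OF bw(1)] w by (simp_all add: cross_bijs_def)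
      then have "w ` cross w U' = D - {v}" by simp
      moreover have "(bij_betw w U' V' \<longleftrightarrow> bij_betw ?u U' V') \<and>
          (bij_betw w U' V' \<longrightarrow> w ` cross w U' = ?u ` cross ?u U')"
        using UU by (intro cong) auto
      ultimately show "?u \<in> cross_bijs U' V' (D - {w a})"
        using bw w UU(1) by (simp add: cross_bijs_def)
    qed
    show "(\<lambda>u. u(b := m, a := v)) ` cross_bijs U' V' (D - {v})
        \<subseteq> {w \<in> cross_bijs U V D. w b = m \<and> w a = v}"
    proof (intro image_subsetI)
      fix u assume u: "u \<in> cross_bijs U' V' (D - {v})"
      let ?w = "u(b := m, a := v)"
      have "(bij_betw u U' V' \<longleftrightarrow> bij_betw ?w U' V') \<and>
          (bij_betw u U' V' \<longrightarrow> u ` cross u U' = ?w ` cross ?w U')"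
        using UU by (intro cong) auto
      then have "bij_betw ?w U' V'" "?w ` cross ?w U' = D - {v}"
        using u by (auto simp: cross_bijs_def)
      moreover have wb: "?w b = m" "?w a = v" using UU by auto
      moreover have bij: "bij_betw ?w U V"
        using bij_iff[OF wb] calculation(1) by blast
      moreover have "?w ` cross ?w U = D"
        unfolding crossU(1)[OF bij wb] calculation(2) using v(1) by blast
      moreover have "\<forall>x. x \<notin> U \<longrightarrow> ?w x = x"
        using u UU by (auto simp: cross_bijs_def)
      ultimately show "?w \<in> {w \<in> cross_bijs U V D. w b = m \<and> w a = v}"
        by (simp add: cross_bijs_def)
    qed
  qed
qed

text \<open>Surjectivity gives a position \<open>b\<close> of \<open>m\<close>; then
  \<open>Min (U - {b})\<close> is the first A-position, so its value lies in \<open>D\<close>, and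
  it is not \<open>m\<close> because only \<open>b\<close> carries that value.\<close>

lemma cross_bijs_decomp:
  assumes U: "finite U" "even (card U)" "U \<noteq> {}" and V: "m = Min V" "finite V" "V \<noteq> {}"
  shows "cross_bijs U V D = (\<Union>(b, v)\<in>U \<times> (D - {m}).
           {w \<in> cross_bijs U V D. w b = m \<and> w (Min (U - {b})) = v})" (is "_ = ?R")
proof
  show "cross_bijs U V D \<subseteq> ?R"
  proof
    fix w assume w: "w \<in> cross_bijs U V D"
    then have bij: "bij_betw w U V" by (simp add: cross_bijs_def)
    have "m \<in> V" using V by simp
    then obtain b where b: "b \<in> U" "w b = m" using bij by (metis bij_betw_def imageE)
    define a where "a = Min (U - {b})"
    have "U - {b} \<noteq> {}"
      using b(1) U by (metis card.empty card_Suc_Diff1 odd_one One_nat_def)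
    then have a: "a \<in> U - {b}"
      using Min_in[of "U - {b}"] U(1) by (simp add: a_def)
    have lt: "w b < w i" if "i \<in> U" "i \<noteq> b" for i
    proof -
      have "w i \<in> V" using bij that by (auto simp: bij_betw_def)
      moreover have "w i \<noteq> m" using bij that b by (metis bij_betw_inv_into_left)
      ultimately show ?thesis using V b(2) Min_le[of V "w i"] by (simp add: order_le_less)
    qed
    have "w a \<in> D"
      using cross_step[where w = w, OF U(1) b(1) lt a_def] w by (auto simp: cross_bijs_def)
    moreover have "w a \<noteq> m" using lt[of a] a b by auto
    ultimately show "w \<in> ?R" using w b by (auto simp: a_def)
  qed
qed auto

section \<open>Heights and their product recursion\<close>

text \<open>With \<open>V\<close> the step positions of a path and \<open>D\<close> its down steps,
  this is the height from which the down step \<open>d\<close> starts. A general \<open>V\<close>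
  allows for the gaps left by deleted steps, without renumbering.\<close>

definition set_height :: "nat set \<Rightarrow> nat set \<Rightarrow> nat \<Rightarrow> int" where
  "set_height V D d = int (card {x \<in> V - D. x < d}) - int (card {x \<in> D. x < d})"

text \<open>With all factors below \<open>v\<close> already lowered, lowering the factor at
  \<open>v\<close> as well decreases the product by exactly the summand of \<open>v\<close>, since
  \<open>f v - (f v - 1) = 1\<close>.\<close>

lemma prod_diff_telescope:
  fixes f :: "'a::linorder \<Rightarrow> 'b::comm_ring_1"
  assumes "finite D"
  shows "(\<Sum>v\<in>D. \<Prod>d\<in>D - {v}. if d < v then f d - 1 else f d)
           = (\<Prod>d\<in>D. f d) - (\<Prod>d\<in>D. f d - 1)"
  using assms
\<comment> \<open>A new maximum \<open>x\<close> multiplies every old summand by \<open>f x\<close>,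
  and in its own summand all factors are lowered.\<close>
proof (induction D rule: finite_linorder_max_induct)
  case (insert x D)
  have x: "x \<notin> D" using insert.hyps by blast
  have "(\<Prod>d\<in>insert x D - {v}. if d < v then f d - 1 else f d)
      = f x * (\<Prod>d\<in>D - {v}. if d < v then f d - 1 else f d)" if "v \<in> D" for v
  proof -
    have "insert x D - {v} = insert x (D - {v})" using that x by auto
    moreover have "\<not> x < v" using that insert.hyps by force
    ultimately show ?thesis using x insert.hyps by simp
  qed
  moreover have "(\<Prod>d\<in>insert x D - {x}. if d < x then f d - 1 else f d) = (\<Prod>d\<in>D. f d - 1)"
    using x insert.hyps by (intro prod.cong) auto
  ultimately have "(\<Sum>v\<in>insert x D. \<Prod>d\<in>insert x D - {v}. if d < v then f d - 1 else f d)
      = (\<Prod>d\<in>D. f d - 1) + f x * ((\<Prod>d\<in>D. f d) - (\<Prod>d\<in>D. f d - 1))"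
    using x insert by (simp add: sum_distrib_left[symmetric])
  then show ?case
    using x insert.hyps by (simp add: algebra_simps)
qed simp

text \<open>The up step \<open>m\<close> precedes every \<open>d\<close>, so deleting it costs 1;
  deleting the down step \<open>v\<close> makes up for this exactly when
  \<open>v < d\<close>.\<close>

lemma set_height_remove:
  assumes "finite V" "m \<in> V" "m \<notin> D" "D \<subseteq> V" "\<And>x. x \<in> V \<Longrightarrow> m \<le> x" "v \<in> D" "d \<in> D - {v}"
  shows "set_height (V - {m} - {v}) (D - {v}) d
           = (if d < v then set_height V D d - 1 else set_height V D d)"
proof -
  have fD: "finite D" using assms finite_subset by blast
  have "m < d" using assms by (metis DiffD1 in_mono order_le_less)
  then have "{x \<in> V - D. x < d} = insert m {x \<in> V - {m} - {v} - (D - {v}). x < d}"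
    using assms by auto
  then have "card {x \<in> V - D. x < d} = Suc (card {x \<in> V - {m} - {v} - (D - {v}). x < d})"
    using assms(1) by simp
  moreover have "card {x \<in> D. x < d} = card {x \<in> D - {v}. x < d} + (if d < v then 0 else 1)"
  proof (cases "d < v")
    case True
    then have "{x \<in> D. x < d} = {x \<in> D - {v}. x < d}" by auto
    then show ?thesis using True by simp
  next
    case False
    then have "{x \<in> D. x < d} = insert v {x \<in> D - {v}. x < d}" using assms by auto
    then show ?thesis using False fD by simp
  qed
  ultimately show ?thesis by (simp add: set_height_def)
qed

text \<open>Heights drop by at most one between consecutive elements of \<open>D\<close>, start above zero and end
  at most at one.\<close>

lemma ex_set_height_1:
  assumes "finite V" "m \<in> V" "m \<notin> D" "D \<subseteq> V" "\<And>x. x \<in> V \<Longrightarrow> m \<le> x"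
    "2 * card D = card V" "D \<noteq> {}"
  shows "\<exists>d\<in>D. set_height V D d = 1"
proof -
  have fD: "finite D" using assms finite_subset by blast
  let ?P = "\<lambda>d. d \<in> D \<and> set_height V D d \<le> 1"
  \<comment> \<open>Before the last down step come \<open>card D - 1\<close> down steps and at most
    \<open>card D\<close> up steps.\<close>
  have "{x \<in> D. x < Max D} = D - {Max D}"
    using fD Max_ge[OF fD] by (auto simp: order_le_less)
  then have "card {x \<in> D. x < Max D} = card D - 1"
    using fD assms(7) by (simp add: card_Diff_singleton)
  moreover have "card {x \<in> V - D. x < Max D} \<le> card (V - D)"
    using assms(1) by (intro card_mono) auto
  moreover have "card (V - D) = card D"
    using assms fD by (simp add: card_Diff_subset)
  moreover have "card D > 0" using fD assms(7) by auto
  ultimately have "?P (Max D)" using fD assms(7) by (simp add: set_height_def)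
  \<comment> \<open>By minimality a predecessor of \<open>d\<close> in \<open>D\<close> has height
    at least 2; if there is none, the up step \<open>m\<close> precedes \<open>d\<close>.\<close>
  define d where "d = (LEAST d. ?P d)"
  have d: "d \<in> D" "set_height V D d \<le> 1" "\<And>e. ?P e \<Longrightarrow> d \<le> e"
    unfolding d_def using LeastI[of ?P, OF \<open>?P (Max D)\<close>] Least_le[of ?P] by auto
  have "set_height V D d \<ge> 1"
  proof (cases "{x \<in> D. x < d} = {}")
    case True
    have "m < d" using assms d by (metis in_mono order_le_less)
    then have "m \<in> {x \<in> V - D. x < d}" using assms by simp
    then have "card {x \<in> V - D. x < d} > 0"
      using assms(1) by (subst card_gt_0_iff) auto
    then show ?thesis unfolding set_height_def True by simp
  next
    case False
    define e where "e = Max {x \<in> D. x < d}"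
    have e: "e \<in> D" "e < d" "\<And>x. x \<in> D \<Longrightarrow> x < d \<Longrightarrow> x \<le> e"
      using Max_in[OF _ False] fD by (auto simp: e_def)
    then have "set_height V D e \<ge> 2" using d(3)[of e] by force
    moreover have "{x \<in> D. x < d} = insert e {x \<in> D. x < e}"
      using e by force
    then have "card {x \<in> D. x < d} = Suc (card {x \<in> D. x < e})" using fD by simp
    moreover have "card {x \<in> V - D. x < e} \<le> card {x \<in> V - D. x < d}"
      using assms(1) e(2) by (intro card_mono) auto
    ultimately show ?thesis by (simp add: set_height_def)
  qed
  then show ?thesis using d by force
qed

text \<open>This is the path side of the recursion: \<open>v\<close> runs over the down steps that
  can be deleted together with the up step \<open>m\<close>.\<close>

lemma prod_set_height_rec:
  assumes "finite V" "m \<in> V" "m \<notin> D" "D \<subseteq> V" "\<And>x. x \<in> V \<Longrightarrow> m \<le> x"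
    "2 * card D = card V" "D \<noteq> {}"
  shows "(\<Sum>v\<in>D. \<Prod>d\<in>D - {v}. set_height (V - {m} - {v}) (D - {v}) d)
           = (\<Prod>d\<in>D. set_height V D d)"
proof -
  have fD: "finite D" using assms finite_subset by blast
  have "(\<Sum>v\<in>D. \<Prod>d\<in>D - {v}. set_height (V - {m} - {v}) (D - {v}) d)
      = (\<Sum>v\<in>D. \<Prod>d\<in>D - {v}. if d < v then set_height V D d - 1 else set_height V D d)"
    using assms(1-5) by (intro sum.cong prod.cong refl set_height_remove)
  also have "\<dots> = (\<Prod>d\<in>D. set_height V D d) - (\<Prod>d\<in>D. set_height V D d - 1)"
    using fD by (rule prod_diff_telescope)
  also have "(\<Prod>d\<in>D. set_height V D d - 1) = 0"
    using ex_set_height_1[OF assms] fD by (auto simp: prod_zero_iff)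
  finally show ?thesis by simp
qed

section \<open>Counting bijections with prescribed A-values\<close>

text \<open>\<open>D\<close> need not come from a Dyck path: the first step below the axis has height 0.\<close>

lemma card_cross_bijs:
  assumes "finite U" "finite V" "card U = 2 * n" "card V = 2 * n" "D \<subseteq> V" "card D = n"
  shows "finite (cross_bijs U V D) \<and>
    int (card (cross_bijs U V D)) = (\<Prod>i=1..n. 2 * int i) * (\<Prod>d\<in>D. set_height V D d)"
  using assms
proof (induction n arbitrary: U V D)
  case 0
  then have "U = {}" "V = {}" "D = {}" by auto
  then have "cross_bijs U V D = {\<lambda>x. x}"
    by (auto simp: cross_bijs_def bij_betw_def)
  then show ?case using \<open>D = {}\<close> by simp
next
  case (Suc n)
  define m where "m = Min V"
  define a where "a b = Min (U - {b})" for b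
  \<comment> \<open>These are the classes by the outcome of the first round.\<close>
  define P where "P b v = {w \<in> cross_bijs U V D. w b = m \<and> w (a b) = v}" for b v
  have fD: "finite D" using Suc.prems finite_subset by blast
  have ne: "U \<noteq> {}" "V \<noteq> {}" "D \<noteq> {}" using Suc.prems by auto
  have ev: "even (card U)" using Suc.prems by simp
  have m: "m \<in> V" "\<And>x. x \<in> V \<Longrightarrow> m \<le> x" using ne Suc.prems by (auto simp: m_def)
  have decomp: "cross_bijs U V D = (\<Union>(b, v)\<in>U \<times> (D - {m}). P b v)"
    unfolding P_def a_def
    using Suc.prems(1) ev ne(1) m_def Suc.prems(2) ne(2) by (rule cross_bijs_decomp)
  have a: "a b \<in> U - {b}" if "b \<in> U" for b
  proof -
    have "card (U - {b}) = Suc (2 * n)" using Suc.prems that by simp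
    then have "U - {b} \<noteq> {}" by (metis card.empty Zero_not_Suc)
    then show ?thesis unfolding a_def using Suc.prems(1) by (intro Min_in) auto
  qed
  have piece: "bij_betw (\<lambda>w. w(b := b, a b := a b)) (P b v)
      (cross_bijs (U - {b} - {a b}) (V - {m} - {v}) (D - {v}))"
    if "b \<in> U" "v \<in> D - {m}" for b v
    unfolding P_def using that a[OF that(1)] ev m_def a_def m(1) Suc.prems
    by (intro cross_bijs_piece) auto
  have cards: "card (U - {b} - {a b}) = 2 * n" "card (V - {m} - {v}) = 2 * n" "card (D - {v}) = n"
    if "b \<in> U" "v \<in> D - {m}" for b v
    using that a[OF that(1)] Suc.prems m(1) fD by auto
  show ?case
  proof (cases "m \<in> D")
    case True
    \<comment> \<open>Later A-values lie in \<open>V - {m} - {v}\<close>, yet \<open>m\<close> is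
      still in \<open>D - {v}\<close>.\<close>
    have "P b v = {}" if bv: "b \<in> U" "v \<in> D - {m}" for b v
    proof -
      have "cross_bijs (U - {b} - {a b}) (V - {m} - {v}) (D - {v}) = {}"
        using cross_bijs_subset[of "U - {b} - {a b}" _ "V - {m} - {v}" "D - {v}"]
          Suc.prems(1) cards[OF bv] True bv by auto
      then show ?thesis using piece[OF bv] by (simp add: bij_betw_def)
    qed
    then have "cross_bijs U V D = {}" by (subst decomp) auto
    moreover have "set_height V D m = 0"
    proof -
      have "{x \<in> V - D. x < m} = {}" "{x \<in> D. x < m} = {}"
        using m(2) Suc.prems(5) by (auto simp: not_less)
      then show ?thesis by (simp only: set_height_def diff_self)
    qed
    then have "(\<Prod>d\<in>D. set_height V D d) = 0" using True fD by (auto simp: prod_zero_iff)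
    ultimately show ?thesis by simp
  next
    case False
    then have Dm: "D - {m} = D" by auto
    have IH: "finite (P b v) \<and> int (card (P b v)) = (\<Prod>i=1..n. 2 * int i) *
        (\<Prod>d\<in>D - {v}. set_height (V - {m} - {v}) (D - {v}) d)"
      if bv: "b \<in> U" "v \<in> D" for b v
    proof -
      have bv': "b \<in> U" "v \<in> D - {m}" using bv Dm by auto
      have "finite (cross_bijs (U - {b} - {a b}) (V - {m} - {v}) (D - {v})) \<and>
          int (card (cross_bijs (U - {b} - {a b}) (V - {m} - {v}) (D - {v})))
            = (\<Prod>i=1..n. 2 * int i) * (\<Prod>d\<in>D - {v}. set_height (V - {m} - {v}) (D - {v}) d)"
        using Suc.prems(1,2,5) False by (intro Suc.IH cards[OF bv']) auto
      then show ?thesis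
        using bij_betw_same_card[OF piece[OF bv']] bij_betw_finite[OF piece[OF bv']] by simp
    qed
    have "card (cross_bijs U V D) = (\<Sum>(b, v)\<in>U \<times> D. card (P b v))"
      unfolding decomp[unfolded Dm]
    proof (subst card_UN_disjoint)
      show "finite (U \<times> D)" using Suc.prems fD by simp
      show "\<forall>i\<in>U \<times> D. finite (case i of (b, v) \<Rightarrow> P b v)"
        using IH by auto
      show "\<forall>i\<in>U \<times> D. \<forall>j\<in>U \<times> D. i \<noteq> j \<longrightarrow>
          (case i of (b, v) \<Rightarrow> P b v) \<inter> (case j of (b, v) \<Rightarrow> P b v) = {}"
      proof -
        \<comment> \<open>\<open>b\<close> is recovered as the position of \<open>m\<close>, and
          \<open>v\<close> as the value at \<open>a b\<close>.\<close>
        have "b = b' \<and> v = v'" if "w \<in> P b v" "w \<in> P b' v'" "b \<in> U" "b' \<in> U" for w b v b' v'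
        proof -
          have "inj_on w U" using that(1) by (simp add: P_def cross_bijs_def bij_betw_def)
          moreover have "w b = w b'" using that(1,2) by (simp add: P_def)
          ultimately have "b = b'" using that(3,4) by (rule inj_onD)
          then show ?thesis using that(1,2) by (simp add: P_def)
        qed
        then show ?thesis by (simp only: split_paired_Ball_Sigma) blast
      qed
    qed (simp add: case_prod_beta)
    then have "int (card (cross_bijs U V D)) = (\<Sum>b\<in>U. \<Sum>v\<in>D. int (card (P b v)))"
      by (simp add: sum.cartesian_product case_prod_beta)
    also have "\<dots> = (\<Sum>b\<in>U. \<Sum>v\<in>D. (\<Prod>i=1..n. 2 * int i) *
        (\<Prod>d\<in>D - {v}. set_height (V - {m} - {v}) (D - {v}) d))"
      using IH by (intro sum.cong refl) blast
    \<comment> \<open>The summand does not depend on \<open>b\<close>, so summing over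
      \<open>U\<close> yields the factor \<open>card U = 2 * Suc n\<close>.\<close>
    also have "\<dots> = 2 * int (Suc n) * (\<Prod>i=1..n. 2 * int i) *
        (\<Sum>v\<in>D. \<Prod>d\<in>D - {v}. set_height (V - {m} - {v}) (D - {v}) d)"
      using Suc.prems(3) by (simp add: sum_distrib_left[symmetric] algebra_simps)
    also have "(\<Sum>v\<in>D. \<Prod>d\<in>D - {v}. set_height (V - {m} - {v}) (D - {v}) d)
        = (\<Prod>d\<in>D. set_height V D d)"
      using Suc.prems m False ne by (intro prod_set_height_rec) auto
    finally have "int (card (cross_bijs U V D))
        = (\<Prod>i=1..Suc n. 2 * int i) * (\<Prod>d\<in>D. set_height V D d)"
      by (simp add: algebra_simps)
    moreover have "finite (cross_bijs U V D)"
      unfolding decomp[unfolded Dm] using IH Suc.prems(1) fD by auto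
    ultimately show ?thesis by blast
  qed
qed

section \<open>Translation back to Dyck paths\<close>

lemma height_eq_card:
  assumes "k \<le> length p"
  shows "height p k = int (card {x \<in> {1..length p} - down_positions p. x \<le> k})
           - int (card {x \<in> down_positions p. x \<le> k})"
  using assms
proof (induction k)
  case 0
  have "{x \<in> down_positions p. x \<le> 0} = {}" by (auto simp: down_positions_def)
  moreover have "{x \<in> {1..length p} - down_positions p. x \<le> 0} = {}" by auto
  ultimately show ?case by (simp only: height_def take_0 count_list.simps diff_self)
next
  case (Suc k)
  define D where "D = down_positions p"
  define E where "E = {1..length p} - D"
  have fin: "finite D" "finite E"
    by (auto simp: D_def E_def down_positions_def)
  have mem: "Suc k \<in> D \<longleftrightarrow> p ! k = Down" "Suc k \<in> E \<longleftrightarrow> p ! k \<noteq> Down"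
    using Suc.prems by (auto simp: D_def E_def down_positions_def)
  have "card {x \<in> X. x \<le> Suc k} = card {x \<in> X. x \<le> k} + (if Suc k \<in> X then 1 else 0)"
    if "finite X" for X :: "nat set"
  proof -
    have "{x \<in> X. x \<le> Suc k} =
        (if Suc k \<in> X then insert (Suc k) {x \<in> X. x \<le> k} else {x \<in> X. x \<le> k})"
      by (auto simp: le_Suc_eq)
    then show ?thesis using that by simp
  qed
  from this[OF fin(1)] this[OF fin(2)] show ?case
    using Suc mem unfolding D_def[symmetric] E_def[symmetric]
    by (cases "p ! k") (auto simp: height_def take_Suc_conv_app_nth)
qed

text \<open>Positions start at 1, so the steps up to \<open>d - 1\<close> are exactly those before
  \<open>d\<close>, without truncation of the subtraction.\<close>

lemma height_pred_eq_set_height: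
  assumes "d \<in> down_positions p"
  shows "height p (d - 1) = set_height {1..length p} (down_positions p) d"
proof -
  have "x \<le> d - 1 \<longleftrightarrow> x < d" for x
    using assms by (auto simp: down_positions_def)
  moreover have "d - 1 \<le> length p" using assms by (auto simp: down_positions_def)
  ultimately show ?thesis by (simp add: height_eq_card set_height_def)
qed

text \<open>Final height 0 equates the numbers of up and down steps.\<close>

lemma card_down_positions:
  assumes "dyck_path (2 * n) p"
  shows "card (down_positions p) = n"
proof -
  have len: "length p = 2 * n" and h: "height p (2 * n) = 0"
    using assms by (auto simp: dyck_path_def)
  have sub: "down_positions p \<subseteq> {1..2 * n}" using len by (auto simp: down_positions_def)
  then have "{x \<in> down_positions p. x \<le> 2 * n} = down_positions p"
    "{x \<in> {1..length p} - down_positions p. x \<le> 2 * n} = {1..2 * n} - down_positions p"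
    using len by auto
  then have "card ({1..2 * n} - down_positions p) = card (down_positions p)"
    using height_eq_card[of "2 * n" p] h len by simp
  moreover have "card ({1..2 * n} - down_positions p) = 2 * n - card (down_positions p)"
    using sub finite_subset[OF sub] by (simp add: card_Diff_subset)
  moreover have "card (down_positions p) \<le> 2 * n"
    using card_mono[OF _ sub] by simp
  ultimately show ?thesis by linarith
qed

lemma prod_down_height:
  assumes "dyck_path (2 * n) p"
  shows "(\<Prod>i=1..n. down_height i p)
           = (\<Prod>d\<in>down_positions p. set_height {1..2 * n} (down_positions p) d)"
proof -
  define D where "D = down_positions p"
  have fin: "finite D" by (simp add: D_def down_positions_def)
  have card: "card D = n" and len: "length p = 2 * n"
    using assms by (auto simp: D_def card_down_positions dyck_path_def)
  \<comment> \<open>Down steps are counted from 1 but list entries from 0.\<close>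
  have "bij_betw (\<lambda>i. i - 1) {1..n} {..<n}"
    by (rule bij_betw_byWitness[where f' = Suc]) auto
  moreover have "bij_betw ((!) (sorted_list_of_set D)) {..<n} D"
    using fin card by (intro bij_betw_nth) auto
  ultimately have "bij_betw ((!) (sorted_list_of_set D) \<circ> (\<lambda>i. i - 1)) {1..n} D"
    by (rule bij_betw_trans)
  then have "bij_betw (\<lambda>i. sorted_list_of_set D ! (i - 1)) {1..n} D"
    by (simp only: o_def)
  then have "(\<Prod>i=1..n. height p (sorted_list_of_set D ! (i - 1) - 1)) = (\<Prod>d\<in>D. height p (d - 1))"
    by (rule prod.reindex_bij_betw)
  also have "\<dots> = (\<Prod>d\<in>D. set_height {1..2 * n} D d)"
    using height_pred_eq_set_height[of _ p] by (intro prod.cong) (simp_all add: D_def len)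
  finally show ?thesis by (simp add: down_height_def D_def)
qed

text \<open>A step list of given length is determined by its down positions, and for
  \<open>path_A n w\<close> these are the A-values of \<open>w\<close>.\<close>

lemma path_A_eq_iff:
  assumes "w permutes {1..2 * n}" "length p = 2 * n"
  shows "path_A n w = p \<longleftrightarrow> w ` cross w {1..2 * n} = down_positions p"
proof -
  have "length (path_A n w) = length p" using assms(2) by (simp add: path_A_def)
  then have "path_A n w = p \<longleftrightarrow> down_positions (path_A n w) = down_positions p"
    using step_list_eqI by blast
  then show ?thesis
    by (simp add: down_positions_path_A[OF assms(1)] crossout_A_def cross_def)
qed

theorem theorem3:
  fixes n :: nat and \<alpha> :: "step list"
  assumes "n \<ge> 1" and "dyck_path (2 * n) \<alpha>"
  shows "int (card {w. w permutes {1..2 * n} \<and> path_A n w = \<alpha>}) =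
           (\<Prod>i=1..n. 2 * int i) * (\<Prod>i=1..n. down_height i \<alpha>)"
proof -
  have len: "length \<alpha> = 2 * n" using assms(2) by (simp add: dyck_path_def)
  have perm: "w permutes {1..2 * n} \<longleftrightarrow>
      bij_betw w {1..2 * n} {1..2 * n} \<and> (\<forall>x. x \<notin> {1..2 * n} \<longrightarrow> w x = x)" for w
    using bij_imp_permutes[of w "{1..2 * n}"] permutes_imp_bij[of w "{1..2 * n}"]
      permutes_not_in[of w "{1..2 * n}"] by blast
  have "{w. w permutes {1..2 * n} \<and> path_A n w = \<alpha>}
      = cross_bijs {1..2 * n} {1..2 * n} (down_positions \<alpha>)"
    unfolding cross_bijs_def using path_A_eq_iff[OF _ len] perm by blast
  moreover have "down_positions \<alpha> \<subseteq> {1..2 * n}"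
    using len by (auto simp: down_positions_def)
  ultimately show ?thesis
    using card_cross_bijs[of "{1..2 * n}" "{1..2 * n}" n "down_positions \<alpha>"]
    unfolding prod_down_height[OF assms(2)] by (simp add: card_down_positions[OF assms(2)])
qed

end
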